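(* Let $(S,\lambda,\rho)$ be a topological unosemigroup such that the topological semigroup $S$ is both left-uniformizable and right-uniformizable. Then $(S,\lambda,\rho)$ is a ditopological unosemigroup.
   Context: A topological semigroup is a non-empty topological space $S$ endowed with a continuous associative binary operation $\cdot:S\times S\to S$. A left (resp. right) unit operation on $S$ is a map $\lambda:S\to S$ with $\lambda(x)\cdot x=x$ (resp. a map $\rho:S\to S$ with $x\cdot\rho(x)=x$) for all $x\in S$. A topological unosemigroup $(S,\lambda,\rho)$ is a topological semigroup $S$ with a continuous left unit operation $\lambda$ and a continuous right unit operation $\rho$. For a uniformity $\mathcal U$ on $S$ and $V\in\mathcal U$ put $B(x,V)=\{z\in S:(x,z)\in V\}$. A topological semigroup $S$ is left-uniformizable (resp. right-uniformizable) if the topology of $S$ is generated by a uniformity $\mathcal U$ such that for every $U\in\mathcal U$ there is $V\in\mathcal U$ with $x\cdot B(y,V)\subset B(xy,U)$ (resp. $B(x,V)\cdot y\subset B(xy,U)$) for all $x,y\in S$. (The uniformities witnessing left- and right-uniformizability may be different.) For $A,B\subset S$ put $A\leftthreetimes B=\{x\in S: ax\in B \text{ for some } a\in A\}$ and $B\rightthreetimes A=\{x\in S: xa\in B\text{ for some }a\in A\}$. A continuous left unit operation $\lambda$ is dicontinuous if for every $x\in S$ and every neighborhood $O_x\subset S$ of $x$ there are a neighborhood $U_x\subset S$ of $x$ and a neighborhood $W_{\lambda(x)}\subset\lambda(S)$ of $\lambda(x)$ in the subspace $\lambda(S)$ such that $(W_{\lambda(x)}\leftthreetimes U_x)\cap\lambda^{-1}(W_{\lambda(x)})\subset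 O_x$. A continuous right unit operation $\rho$ is dicontinuous if for every $x\in S$ and every neighborhood $O_x\subset S$ of $x$ there are a neighborhood $U_x\subset S$ of $x$ and a neighborhood $W_{\rho(x)}\subset\rho(S)$ of $\rho(x)$ in the subspace $\rho(S)$ such that $(U_x\rightthreetimes W_{\rho(x)})\cap\rho^{-1}(W_{\rho(x)})\subset O_x$. A topological unosemigroup $(S,\lambda,\rho)$ is ditopological if both $\lambda$ and $\rho$ are dicontinuous. *)

theory Defs
  imports "HOL-Analysis.Analysis"
begin

text \<open>
  Topological semigroups are the types of class \<^class>\<open>topological_semigroup_mult\<close>: an associative,
  jointly continuous multiplication. Neighbourhoods are taken to be open, in the subspace
  \<open>range \<lambda>\<close> as well as in the whole space. No separation axiom is assumed.
\<close>

definition left_unit_operation :: "('a::semigroup_mult \<Rightarrow> 'a) \<Rightarrow> bool"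
  where "left_unit_operation l \<longleftrightarrow> (\<forall>x. l x * x = x)"

definition right_unit_operation :: "('a::semigroup_mult \<Rightarrow> 'a) \<Rightarrow> bool"
  where "right_unit_operation r \<longleftrightarrow> (\<forall>x. x * r x = x)"

definition topological_unosemigroup ::
    "('a::topological_semigroup_mult \<Rightarrow> 'a) \<Rightarrow> ('a \<Rightarrow> 'a) \<Rightarrow> bool"
  where "topological_unosemigroup l r \<longleftrightarrow>
    left_unit_operation l \<and> continuous_on UNIV l \<and>
    right_unit_operation r \<and> continuous_on UNIV r"

text \<open>
  A uniformity is a filter \<open>\<U>\<close> on pairs, as in \<^class>\<open>uniform_space\<close>; its entourages are the sets \<open>V\<close>
  with \<open>\<forall>\<^sub>F p in \<U>. p \<in> V\<close>. A space may carry several uniformities generating its topology, so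
  the class is used as a predicate on \<open>\<U>\<close>: \<open>class.uniform_space open \<U>\<close> says that \<open>\<U>\<close> satisfies
  the axioms of a uniformity and generates the given topology.
\<close>

definition entourage :: "('a \<times> 'a) filter \<Rightarrow> ('a \<times> 'a) set \<Rightarrow> bool"
  where "entourage \<U> V \<longleftrightarrow> (\<forall>\<^sub>F p in \<U>. p \<in> V)"

definition entourage_ball :: "'a \<Rightarrow> ('a \<times> 'a) set \<Rightarrow> 'a set"
  where "entourage_ball x V = {z. (x, z) \<in> V}"

definition left_uniformizable :: "'a::topological_semigroup_mult itself \<Rightarrow> bool"
  where "left_uniformizable _ \<longleftrightarrow>
    (\<exists>\<U> :: ('a \<times> 'a) filter. class.uniform_space open \<U> \<and>
      (\<forall>U. entourage \<U> U \<longrightarrow> (\<exists>V. entourage \<U> V \<and>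
        (\<forall>x y. (\<lambda>z. x * z) ` entourage_ball y V \<subseteq> entourage_ball (x * y) U))))"

definition right_uniformizable :: "'a::topological_semigroup_mult itself \<Rightarrow> bool"
  where "right_uniformizable _ \<longleftrightarrow>
    (\<exists>\<U> :: ('a \<times> 'a) filter. class.uniform_space open \<U> \<and>
      (\<forall>U. entourage \<U> U \<longrightarrow> (\<exists>V. entourage \<U> V \<and>
        (\<forall>x y. (\<lambda>z. z * y) ` entourage_ball x V \<subseteq> entourage_ball (x * y) U))))"

text \<open>
  \<open>left_quotient A B\<close> is \<open>{x. \<exists>a\<in>A. a x \<in> B}\<close>, written with \<open>A\<close> to the left of \<open>B\<close>;
  \<open>right_quotient B A\<close> is \<open>{x. \<exists>a\<in>A. x a \<in> B}\<close>, written with \<open>B\<close> to the left of \<open>A\<close>.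
\<close>

definition left_quotient :: "'a::semigroup_mult set \<Rightarrow> 'a set \<Rightarrow> 'a set"
  where "left_quotient A B = {x. \<exists>a\<in>A. a * x \<in> B}"

definition right_quotient :: "'a::semigroup_mult set \<Rightarrow> 'a set \<Rightarrow> 'a set"
  where "right_quotient B A = {x. \<exists>a\<in>A. x * a \<in> B}"

definition dicontinuous_left_unit :: "('a::topological_semigroup_mult \<Rightarrow> 'a) \<Rightarrow> bool"
  where "dicontinuous_left_unit l \<longleftrightarrow>
    left_unit_operation l \<and> continuous_on UNIV l \<and>
    (\<forall>x Ox. open Ox \<and> x \<in> Ox \<longrightarrow>
      (\<exists>U W. open U \<and> x \<in> U \<and> openin (top_of_set (range l)) W \<and> l x \<in> W \<and>
        left_quotient W U \<inter> l -` W \<subseteq> Ox))"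

definition dicontinuous_right_unit :: "('a::topological_semigroup_mult \<Rightarrow> 'a) \<Rightarrow> bool"
  where "dicontinuous_right_unit r \<longleftrightarrow>
    right_unit_operation r \<and> continuous_on UNIV r \<and>
    (\<forall>x Ox. open Ox \<and> x \<in> Ox \<longrightarrow>
      (\<exists>U W. open U \<and> x \<in> U \<and> openin (top_of_set (range r)) W \<and> r x \<in> W \<and>
        right_quotient U W \<inter> r -` W \<subseteq> Ox))"

definition ditopological_unosemigroup ::
    "('a::topological_semigroup_mult \<Rightarrow> 'a) \<Rightarrow> ('a \<Rightarrow> 'a) \<Rightarrow> bool"
  where "ditopological_unosemigroup l r \<longleftrightarrow>
    topological_unosemigroup l r \<and> dicontinuous_left_unit l \<and> dicontinuous_right_unit r"

end

theory Submission
  imports Defs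
begin

text \<open>
  Right-uniformizability gives dicontinuity of \<open>\<lambda>\<close>: if \<open>a\<close> and \<open>\<lambda>(y)\<close> are both close to \<open>\<lambda>(x)\<close>,
  they are close to each other, and translating by \<open>y\<close> shows that \<open>a y\<close> is close to
  \<open>\<lambda>(y) y = y\<close>, uniformly in \<open>y\<close>. So if moreover \<open>a y\<close> is close to \<open>x\<close>, then so is \<open>y\<close>.
  The case of \<open>\<rho>\<close> is the same in the opposite semigroup.
\<close>

lemma (in uniform_space) open_subset_uniform_ball:
  assumes "eventually P uniformity"
  obtains S where "open S" "x \<in> S" "\<And>y. y \<in> S \<Longrightarrow> P (x, y)"
proof -
  have "eventually (\<lambda>y. P (x, y)) (nhds x)"
    unfolding eventually_nhds_uniformity using assms by (rule eventually_mono) auto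
  then show thesis
    unfolding eventually_nhds using that by blast
qed

text \<open>Intersecting a half-size entourage with its inverse lets its pairs be read in either
  direction. Two points are then compared through a common second entry or a common first entry;
  both forms are needed below.\<close>

lemma (in uniform_space) uniformity_transE_sym:
  assumes "eventually E uniformity"
  obtains D where "eventually D uniformity"
    "\<And>x y z. D (x, y) \<Longrightarrow> D (z, y) \<Longrightarrow> E (x, z)"
    "\<And>x y z. D (y, x) \<Longrightarrow> D (y, z) \<Longrightarrow> E (x, z)"
proof -
  obtain D where D: "eventually D uniformity" "\<And>x y z. D (x, y) \<Longrightarrow> D (y, z) \<Longrightarrow> E (x, z)"
    using uniformity_transE[OF assms] by blast
  have "eventually (\<lambda>(x, y). D (y, x)) uniformity"
    by (rule uniformity_sym) (use D(1) in simp)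
  with D(1) have "eventually (\<lambda>p. D p \<and> (case p of (x, y) \<Rightarrow> D (y, x))) uniformity"
    by (rule eventually_conj)
  then show thesis
    by (rule that) (use D(2) in auto)
qed

text \<open>The operation \<open>m\<close> stands for the multiplication or its opposite.\<close>

lemma (in uniform_space) uniform_translations_imp_dicontinuous:
  assumes uniformly_continuous: "\<And>E. eventually E uniformity \<Longrightarrow>
      \<exists>D. eventually D uniformity \<and> (\<forall>x y z. D (x, z) \<longrightarrow> E (m x y, m z y))"
    and unit: "\<And>x. m (l x) x = x"
    and "open O'" "x \<in> O'"
  obtains U W where "open U" "x \<in> U" "open W" "l x \<in> W"
    "\<And>a y. a \<in> W \<Longrightarrow> l y \<in> W \<Longrightarrow> m a y \<in> U \<Longrightarrow> y \<in> O'"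
proof -
  have "eventually (\<lambda>(x', y). x' = x \<longrightarrow> y \<in> O') uniformity"
    using assms(3,4) open_uniformity by blast
  \<comment> \<open>The common second entry \<open>z\<close> will be \<open>m a y\<close>: it is
    \<open>E\<close>-close to \<open>x\<close> through \<open>U\<close>, and to \<open>y\<close>
    through the unit law.\<close>
  then obtain E where E: "eventually E uniformity"
    "\<And>y z. E (x, z) \<Longrightarrow> E (y, z) \<Longrightarrow> y \<in> O'"
    by (rule uniformity_transE_sym) auto
  obtain D where D: "eventually D uniformity" "\<And>x y z. D (x, z) \<Longrightarrow> E (m x y, m z y)"
    using uniformly_continuous[OF E(1)] by blast
  \<comment> \<open>Here the common entry is \<open>b = l x\<close>: if \<open>l y\<close> and
    \<open>a\<close> are both \<open>C\<close>-close to it, then \<open>D (l y, a)\<close>.\<close>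
  obtain C where C: "eventually C uniformity" "\<And>a b c. C (b, a) \<Longrightarrow> C (b, c) \<Longrightarrow> D (a, c)"
    using D(1) by (rule uniformity_transE_sym) blast
  obtain U where U: "open U" "x \<in> U" "\<And>y. y \<in> U \<Longrightarrow> E (x, y)"
    using E(1) by (rule open_subset_uniform_ball[where x = x]) blast
  obtain W where W: "open W" "l x \<in> W" "\<And>y. y \<in> W \<Longrightarrow> C (l x, y)"
    using C(1) by (rule open_subset_uniform_ball[where x = "l x"]) blast
  have "y \<in> O'" if "a \<in> W" "l y \<in> W" "m a y \<in> U" for a y
  proof -
    have "E (m (l y) y, m a y)"
      using D(2) C(2) W(3) that by blast
    then have "E (y, m a y)"
      by (simp add: unit)
    with U(3)[OF that(3)] show ?thesis
      by (rule E(2))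
  qed
  with U W show thesis
    using that by blast
qed

lemma entourage_Collect: "entourage \<U> {p. P p} \<longleftrightarrow> eventually P \<U>"
  by (simp add: entourage_def)

text \<open>Between \<open>l y * y\<close> and \<open>a * y\<close> only the left factor changes,
  and right-uniformizability controls this change uniformly in \<open>y\<close>.\<close>

lemma right_uniformizable_imp_dicontinuous_left_unit:
  fixes l :: "'a::topological_semigroup_mult \<Rightarrow> 'a"
  assumes l: "left_unit_operation l" "continuous_on UNIV l"
    and "right_uniformizable TYPE('a)"
  shows "dicontinuous_left_unit l"
  unfolding dicontinuous_left_unit_def
proof (intro conjI l allI impI, elim conjE)
  fix x :: 'a and O' assume O': "open O'" "x \<in> O'"
  obtain \<U> :: "('a \<times> 'a) filter" where \<U>: "class.uniform_space open \<U>"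
    and *: "\<And>U. entourage \<U> U \<Longrightarrow> \<exists>V. entourage \<U> V \<and>
        (\<forall>x y. (\<lambda>z. z * y) ` entourage_ball x V \<subseteq> entourage_ball (x * y) U)"
    using assms(3) unfolding right_uniformizable_def by blast
  have uniformly_continuous: "\<exists>D. eventually D \<U> \<and> (\<forall>x y z. D (x, z) \<longrightarrow> E (x * y, z * y))"
    if "eventually E \<U>" for E
  proof -
    obtain V where "entourage \<U> V"
      "\<forall>x y. (\<lambda>z. z * y) ` entourage_ball x V \<subseteq> entourage_ball (x * y) {p. E p}"
      using *[of "{p. E p}"] \<open>eventually E \<U>\<close> unfolding entourage_Collect by blast
    then show ?thesis
      by (intro exI[of _ "\<lambda>p. p \<in> V"]) (auto simp: entourage_def entourage_ball_def)
  qed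
  have unit: "l y * y = y" for y
    using l(1) by (simp add: left_unit_operation_def)
  obtain U W where UW: "open U" "x \<in> U" "open W" "l x \<in> W"
    "\<And>a y. a \<in> W \<Longrightarrow> l y \<in> W \<Longrightarrow> a * y \<in> U \<Longrightarrow> y \<in> O'"
    using uniform_space.uniform_translations_imp_dicontinuous
      [OF \<U>, where m = "(*)" and l = l, OF uniformly_continuous unit O'] by blast
  show "\<exists>U W. open U \<and> x \<in> U \<and> openin (top_of_set (range l)) W \<and> l x \<in> W \<and>
      left_quotient W U \<inter> l -` W \<subseteq> O'"
    \<comment> \<open>\<open>W\<close> is open in the whole space, so its trace is open in the
      subspace \<open>range l\<close>; it still contains \<open>l x\<close>, and passing to it only
      restricts the choice of \<open>a\<close>.\<close>
    using UW by (intro exI[of _ U] exI[of _ "range l \<inter> W"])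
      (auto simp: left_quotient_def openin_open)
qed

text \<open>The uniformity is chosen afresh on this side, because the two uniformizability
  hypotheses need not share one.\<close>

lemma left_uniformizable_imp_dicontinuous_right_unit:
  fixes r :: "'a::topological_semigroup_mult \<Rightarrow> 'a"
  assumes r: "right_unit_operation r" "continuous_on UNIV r"
    and "left_uniformizable TYPE('a)"
  shows "dicontinuous_right_unit r"
  unfolding dicontinuous_right_unit_def
proof (intro conjI r allI impI, elim conjE)
  fix x :: 'a and O' assume O': "open O'" "x \<in> O'"
  obtain \<U> :: "('a \<times> 'a) filter" where \<U>: "class.uniform_space open \<U>"
    and *: "\<And>U. entourage \<U> U \<Longrightarrow> \<exists>V. entourage \<U> V \<and>
        (\<forall>x y. (\<lambda>z. x * z) ` entourage_ball y V \<subseteq> entourage_ball (x * y) U)"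
    using assms(3) unfolding left_uniformizable_def by blast
  have uniformly_continuous: "\<exists>D. eventually D \<U> \<and> (\<forall>x y z. D (x, z) \<longrightarrow> E (y * x, y * z))"
    if "eventually E \<U>" for E
  proof -
    obtain V where "entourage \<U> V"
      "\<forall>x y. (\<lambda>z. x * z) ` entourage_ball y V \<subseteq> entourage_ball (x * y) {p. E p}"
      using *[of "{p. E p}"] \<open>eventually E \<U>\<close> unfolding entourage_Collect by blast
    then show ?thesis
      by (intro exI[of _ "\<lambda>p. p \<in> V"]) (auto simp: entourage_def entourage_ball_def)
  qed
  have unit: "y * r y = y" for y
    using r(1) by (simp add: right_unit_operation_def)
  obtain U W where UW: "open U" "x \<in> U" "open W" "r x \<in> W"
    "\<And>a y. a \<in> W \<Longrightarrow> r y \<in> W \<Longrightarrow> y * a \<in> U \<Longrightarrow> y \<in> O'"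
    \<comment> \<open>Reading \<open>m a y\<close> as \<open>y * a\<close> turns left translation by
      \<open>y\<close> into the map sending \<open>a\<close> to \<open>m a y\<close>, and the law
      \<open>m (r y) y = y\<close> into \<open>y * r y = y\<close>.\<close>
    using uniform_space.uniform_translations_imp_dicontinuous
      [OF \<U>, where m = "\<lambda>a y. y * a" and l = r, OF uniformly_continuous unit O'] by blast
  show "\<exists>U W. open U \<and> x \<in> U \<and> openin (top_of_set (range r)) W \<and> r x \<in> W \<and>
      right_quotient U W \<inter> r -` W \<subseteq> O'"
    using UW by (intro exI[of _ U] exI[of _ "range r \<inter> W"])
      (auto simp: right_quotient_def openin_open)
qed

theorem theorem3:
  fixes l r :: "'a::topological_semigroup_mult \<Rightarrow> 'a"
  assumes "topological_unosemigroup l r"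
    and "left_uniformizable TYPE('a)"
    and "right_uniformizable TYPE('a)"
  shows "ditopological_unosemigroup l r"
  using assms right_uniformizable_imp_dicontinuous_left_unit
    left_uniformizable_imp_dicontinuous_right_unit
  unfolding ditopological_unosemigroup_def topological_unosemigroup_def by blast

end
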